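(* Let $\Phi=(D,\varphi)$ be a $\mathbb{T}$-gain digraph whose underlying digraph $D$ is strongly connected. Then $\rho(\Phi)=\Delta^+$ if and only if $D$ is $\Delta^+$-out-regular and $\Phi$ is $\mu$-balanced for some $\mu\in\mathbb{T}$.
   Context: A digraph $D=(V,\mathcal{A})$ has a finite vertex set $V=\{v_1,\dots,v_n\}$ and a set $\mathcal{A}$ of ordered pairs of distinct vertices, called arcs (no loops; at most one arc from $v_i$ to $v_j$ for each ordered pair; opposite arcs may both be present). The out-degree $\deg^+(v)$ is the number of arcs leaving $v$, and $\Delta^+=\max_i\deg^+(v_i)$; $D$ is $\Delta^+$-out-regular if $\deg^+(v)=\Delta^+$ for every vertex $v$. A directed cycle is a closed directed walk whose vertices are distinct except that the first and last coincide (so its length is at least $2$; length $2$ is allowed). $D$ is strongly connected if every ordered pair of vertices is joined by a directed path. Let $\mathbb{T}=\{z\in\mathbb{C}:|z|=1\}$. A $\mathbb{T}$-gain digraph is a pair $\Phi=(D,\varphi)$ with $\varphi:\mathcal{A}\to\mathbb{T}$ an arbitrary function (no relation between gains of opposite arcs). Its gain adjacency matrix $A(\Phi)$ has entries $A(\Phi)_{ij}=\varphi(v_i,v_j)$ if $(v_i,v_j)\in\mathcal{A}$ and $0$ otherwise. $\rho(\Phi)$ is the spectral radius (maximum modulus of a complex eigenvalue) of $A(\Phi)$. The gain $\varphi(C)$ of a directed cycle is the product of the gains of its arcs. For $\mu\in\mathbb{T}$, $\Phi$ is $\mu$-balanced if $\varphi(C)=\mu^{|C|}$ for every directed cycle $C$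 of $D$, where $|C|$ is the length of $C$. *)

theory Defs
  imports "Graph_Theory.Graph_Theory" "Jordan_Normal_Form.Spectral_Radius"
begin

(* D is a finite loop-free digraph whose arcs are ordered pairs of vertices (locale pair_digraph);
   a gain function is a map phi on pairs of which only the values on parcs D matter. *)

definition unit_circle :: "complex set" where
  "unit_circle = {z. cmod z = 1}"

definition is_T_gain_digraph :: "'a pair_pre_digraph \<Rightarrow> ('a \<times> 'a \<Rightarrow> complex) \<Rightarrow> bool" where
  "is_T_gain_digraph D \<phi> \<longleftrightarrow> pair_digraph D \<and> (\<forall>a \<in> parcs D. \<phi> a \<in> unit_circle)"

definition max_out_degree :: "'a pair_pre_digraph \<Rightarrow> nat" where
  "max_out_degree D = Max (out_degree (with_proj D) ` pverts D)"

definition out_regular :: "'a pair_pre_digraph \<Rightarrow> nat \<Rightarrow> bool" where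
  "out_regular D r \<longleftrightarrow> (\<forall>v \<in> pverts D. out_degree (with_proj D) v = r)"

(* The list vs = [v_1, ..., v_n] fixes the order of the vertices indexing rows and columns. *)
definition gain_adj_mat ::
    "'a list \<Rightarrow> 'a pair_pre_digraph \<Rightarrow> ('a \<times> 'a \<Rightarrow> complex) \<Rightarrow> complex mat" where
  "gain_adj_mat vs D \<phi> = mat (length vs) (length vs)
     (\<lambda>(i, j). if (vs ! i, vs ! j) \<in> parcs D then \<phi> (vs ! i, vs ! j) else 0)"

(* A walk is the list of its arcs, so its length is its number of arcs. *)
definition walk_gain :: "('a \<times> 'a \<Rightarrow> complex) \<Rightarrow> ('a \<times> 'a) awalk \<Rightarrow> complex" where
  "walk_gain \<phi> p = prod_list (map \<phi> p)"

(* pre_digraph.cycle allows loops as cycles of length 1, but these do not exist in a loop-free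
   digraph; cycles of length 2 are included. *)
definition balanced ::
    "complex \<Rightarrow> 'a pair_pre_digraph \<Rightarrow> ('a \<times> 'a \<Rightarrow> complex) \<Rightarrow> bool" where
  "balanced \<mu> D \<phi> \<longleftrightarrow>
     (\<forall>C. pre_digraph.cycle (with_proj D) C \<longrightarrow> walk_gain \<phi> C = \<mu> ^ length C)"

end

theory Submission
  imports Defs "HOL-Analysis.Inner_Product"
begin

text \<open>
  Let \<open>k\<close> be an eigenvalue with eigenvector \<open>x\<close>. The eigenvalue equation at a vertex where
  \<open>cmod x\<close> is maximal gives \<open>cmod k \<le> \<Delta>\<close>. In the case of equality the triangle inequality is
  tight there: the vertex has out-degree \<open>\<Delta>\<close> and every arc \<open>(v, w)\<close> leaving it satisfies
  \<open>\<phi> (v, w) * x w = \<mu> * x v\<close> with \<open>\<mu> = k / \<Delta>\<close>, so that the maximum is also attained at \<open>w\<close>.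
  By strong connectivity this holds everywhere. Multiplying along a closed walk shows that its
  gain is \<open>\<mu> ^ length\<close>.

  Conversely, in a balanced digraph all closed walks, not only the cycles, have gain
  \<open>\<mu> ^ length\<close>. Hence \<open>\<mu> ^ length p / walk_gain \<phi> p\<close> depends only on the end point of a walk \<open>p\<close>
  from a fixed root, and out-regularity makes it an eigenvector for \<open>\<Delta> * \<mu>\<close>.
\<close>

section \<open>Equality in the triangle inequality\<close>

text \<open>The variance identity: \<open>m\<close> is the mean of \<open>f\<close>, given through
  the sum so that an empty \<open>S\<close> needs no exception.\<close>

lemma sum_norm_diff_mean_square:
  fixes f :: "'i \<Rightarrow> 'b::real_inner"
  assumes m: "sum f S = of_nat (card S) *\<^sub>R m"
  shows "(\<Sum>i\<in>S. (norm (f i - m))\<^sup>2) = (\<Sum>i\<in>S. (norm (f i))\<^sup>2) - card S * (norm m)\<^sup>2"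
proof -
  have "(\<Sum>i\<in>S. (norm (f i - m))\<^sup>2) =
      (\<Sum>i\<in>S. (norm (f i))\<^sup>2 - 2 * inner (f i) m + (norm m)\<^sup>2)"
    by (simp add: power2_norm_eq_inner inner_diff inner_commute algebra_simps)
  also have "\<dots> = (\<Sum>i\<in>S. (norm (f i))\<^sup>2) - 2 * inner (sum f S) m + card S * (norm m)\<^sup>2"
    by (simp add: sum.distrib sum_subtractf inner_sum_left sum_distrib_left)
  finally show ?thesis
    by (simp add: m power2_norm_eq_inner)
qed

text \<open>No term is longer than the mean \<open>m\<close>, so the variance is at most 0 and every
  term coincides with \<open>m\<close>.\<close>

lemma tight_triangle_inequality:
  fixes f :: "'i \<Rightarrow> 'b::real_inner"
  assumes "finite S" and le: "\<And>i. i \<in> S \<Longrightarrow> norm (f i) \<le> norm m"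
    and m: "sum f S = of_nat (card S) *\<^sub>R m" and "i \<in> S"
  shows "f i = m"
proof -
  have "(\<Sum>i\<in>S. (norm (f i))\<^sup>2) \<le> card S * (norm m)\<^sup>2"
    by (rule sum_bounded_above) (simp add: le power_mono)
  then have "(\<Sum>i\<in>S. (norm (f i - m))\<^sup>2) \<le> 0"
    by (simp add: sum_norm_diff_mean_square[OF m])
  then have "(\<Sum>i\<in>S. (norm (f i - m))\<^sup>2) = 0"
    by (intro antisym sum_nonneg) auto
  then show ?thesis
    using assms(1,4) by (simp add: sum_nonneg_eq_0_iff)
qed

section \<open>Eigenvectors as functions on vertices\<close>

text \<open>As \<open>vs\<close> lists each element once, vectors indexed by positions correspond to
  functions on \<open>set vs\<close>; later arguments can thus avoid indices.\<close>

lemma eigenvalue_mat_nth_iff: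
  fixes B :: "'a \<Rightarrow> 'a \<Rightarrow> 'b::comm_ring_1"
  assumes "distinct vs"
  shows "eigenvalue (mat (length vs) (length vs) (\<lambda>(i, j). B (vs ! i) (vs ! j))) k \<longleftrightarrow>
    (\<exists>x. (\<exists>v\<in>set vs. x v \<noteq> 0) \<and> (\<forall>v\<in>set vs. (\<Sum>w\<in>set vs. B v w * x w) = k * x v))"
    (is "eigenvalue ?A k \<longleftrightarrow> ?R")
proof -
  let ?n = "length vs"
  have bij: "bij_betw ((!) vs) {0..<?n} (set vs)"
    using bij_betw_nth[OF assms, of "{0..<?n}" "set vs"] by (simp add: lessThan_atLeast0)
  have sum: "(\<Sum>w\<in>set vs. g w) = (\<Sum>j=0..<?n. g (vs ! j))" for g :: "'a \<Rightarrow> 'b"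
    using sum.reindex_bij_betw[OF bij, of g] by simp
  have all: "(\<forall>v\<in>set vs. P v) \<longleftrightarrow> (\<forall>i<?n. P (vs ! i))" for P
    by (fact all_set_conv_all_nth)
  have ex: "(\<exists>v\<in>set vs. P v) \<longleftrightarrow> (\<exists>i<?n. P (vs ! i))" for P
    using all[of "\<lambda>v. \<not> P v"] by blast
  have ev: "eigenvector ?A (vec ?n (\<lambda>i. x (vs ! i))) k \<longleftrightarrow>
      (\<exists>v\<in>set vs. x v \<noteq> 0) \<and> (\<forall>v\<in>set vs. (\<Sum>w\<in>set vs. B v w * x w) = k * x v)" for x
  proof -
    let ?u = "vec ?n (\<lambda>i. x (vs ! i))"
    have "?u \<noteq> 0\<^sub>v ?n \<longleftrightarrow> (\<exists>v\<in>set vs. x v \<noteq> 0)"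
      unfolding ex by (auto simp only: vec_eq_iff dim_vec index_vec index_zero_vec)
    moreover have "?A *\<^sub>v ?u = k \<cdot>\<^sub>v ?u \<longleftrightarrow>
        (\<forall>v\<in>set vs. (\<Sum>w\<in>set vs. B v w * x w) = k * x v)"
      unfolding sum all by (simp add: vec_eq_iff scalar_prod_def)
    ultimately show ?thesis
      by (simp add: eigenvector_def)
  qed
  show ?thesis
  proof
    assume "eigenvalue ?A k"
    then obtain u where u: "eigenvector ?A u k"
      by (auto simp: eigenvalue_def)
    define x where "x v = u $ the_inv_into {0..<?n} ((!) vs) v" for v
    have "dim_vec u = ?n"
      using u[unfolded eigenvector_def, THEN conjunct1] by simp
    moreover have "x (vs ! i) = u $ i" if "i < ?n" for i
      unfolding x_def by (subst the_inv_into_f_f[OF bij_betw_imp_inj_on[OF bij]]) (use that in auto)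
    ultimately have "u = vec ?n (\<lambda>i. x (vs ! i))"
      by (intro eq_vecI) simp_all
    with u have "eigenvector ?A (vec ?n (\<lambda>i. x (vs ! i))) k"
      by simp
    then show ?R
      unfolding ev by (rule exI[of _ x])
  next
    assume ?R
    then obtain x where "eigenvector ?A (vec ?n (\<lambda>i. x (vs ! i))) k"
      unfolding ev[symmetric] by (rule exE)
    then show "eigenvalue ?A k"
      unfolding eigenvalue_def by (rule exI)
  qed
qed

section \<open>Walk gains, out-degrees and the local eigenvalue equation\<close>

locale T_gain_digraph = pair_digraph D for D :: "'a pair_pre_digraph" +
  fixes \<phi> :: "'a \<times> 'a \<Rightarrow> complex"
  assumes norm_gain: "e \<in> parcs D \<Longrightarrow> cmod (\<phi> e) = 1"
begin

lemma walk_gain_Nil [simp]: "walk_gain \<phi> [] = 1"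
  and walk_gain_Cons [simp]: "walk_gain \<phi> (e # p) = \<phi> e * walk_gain \<phi> p"
  and walk_gain_append [simp]: "walk_gain \<phi> (p @ q) = walk_gain \<phi> p * walk_gain \<phi> q"
  by (simp_all add: walk_gain_def)

lemma walk_gain_nonzero: "awalk u p v \<Longrightarrow> walk_gain \<phi> p \<noteq> 0"
  using norm_gain by (fastforce simp: walk_gain_def prod_list_zero_iff awalk_def)

lemma finite_out_nbrs [simp]: "finite {w. (v, w) \<in> parcs D}"
  by (rule finite_subset[OF _ pair_finite_verts]) (auto dest: in_arcsD2)

lemma out_degree_eq_card: "out_degree (with_proj D) v = card {w. (v, w) \<in> parcs D}"
proof -
  have "out_arcs (with_proj D) v = Pair v ` {w. (v, w) \<in> parcs D}"
    by (auto simp: out_arcs_def)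
  then show ?thesis
    by (simp add: out_degree_def card_image inj_on_def)
qed

lemma out_degree_le_max: "v \<in> pverts D \<Longrightarrow> out_degree (with_proj D) v \<le> max_out_degree D"
  unfolding max_out_degree_def by (rule Max_ge) (auto intro: pair_finite_verts)

text \<open>Dropping the zero entries of a row leaves one summand per out-neighbour, which ties the
  equation to the out-degree.\<close>

lemma eigenvalue_gain_adj_mat_iff:
  assumes "distinct vs" and vs: "set vs = pverts D"
  shows "eigenvalue (gain_adj_mat vs D \<phi>) k \<longleftrightarrow>
    (\<exists>x. (\<exists>v\<in>pverts D. x v \<noteq> 0) \<and>
      (\<forall>v\<in>pverts D. (\<Sum>w | (v, w) \<in> parcs D. \<phi> (v, w) * x w) = k * x v))"
proof -
  have "(\<Sum>w\<in>pverts D. (if (v, w) \<in> parcs D then \<phi> (v, w) else 0) * x w) =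
      (\<Sum>w | (v, w) \<in> parcs D. \<phi> (v, w) * x w)" for v x
    by (rule sum.mono_neutral_cong_right) (auto simp: pair_finite_verts dest: in_arcsD2)
  then show ?thesis
    unfolding gain_adj_mat_def
      eigenvalue_mat_nth_iff[OF assms(1), of "\<lambda>v w. if (v, w) \<in> parcs D then \<phi> (v, w) else 0"] vs
    by simp
qed

section \<open>The bound by the maximal out-degree\<close>

text \<open>Gains have modulus 1, so no summand exceeds \<open>x v\<close> in modulus. In the case
  of equality the mean of the summands has the same modulus as \<open>x v\<close>, and the tight
  triangle inequality makes each summand equal to this mean.\<close>

lemma eigenvalue_at_max_vertex:
  assumes v: "v \<in> pverts D" and xv: "x v \<noteq> 0"
    and max: "\<And>w. w \<in> pverts D \<Longrightarrow> cmod (x w) \<le> cmod (x v)"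
    and ev: "(\<Sum>w | (v, w) \<in> parcs D. \<phi> (v, w) * x w) = k * x v"
  shows "cmod k \<le> out_degree (with_proj D) v"
    and "cmod k = out_degree (with_proj D) v \<Longrightarrow> (v, w) \<in> parcs D \<Longrightarrow>
      \<phi> (v, w) * x w = k / out_degree (with_proj D) v * x v"
proof -
  let ?d = "out_degree (with_proj D) v" and ?S = "{w. (v, w) \<in> parcs D}"
  have le: "cmod (\<phi> (v, w) * x w) \<le> cmod (x v)" if "w \<in> ?S" for w
    using that max[of w] by (auto simp: norm_mult norm_gain dest: in_arcsD2)
  have "cmod k * cmod (x v) = cmod (\<Sum>w\<in>?S. \<phi> (v, w) * x w)"
    by (simp add: ev norm_mult)
  also have "\<dots> \<le> of_nat (card ?S) * cmod (x v)"
    by (rule sum_norm_bound) (rule le)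
  finally show "cmod k \<le> ?d"
    using xv by (simp add: out_degree_eq_card)
  assume k: "cmod k = ?d" and w: "(v, w) \<in> parcs D"
  \<comment> \<open>The arc \<open>(v, w)\<close> excludes out-degree 0, for which
    \<open>k / ?d\<close> would be a division by zero.\<close>
  have "card ?S > 0"
    using w by (auto simp: card_gt_0_iff)
  then have d: "?d > 0"
    by (simp add: out_degree_eq_card)
  show "\<phi> (v, w) * x w = k / ?d * x v"
  proof (rule tight_triangle_inequality[of ?S "\<lambda>w. \<phi> (v, w) * x w"])
    show "(\<Sum>w\<in>?S. \<phi> (v, w) * x w) = of_nat (card ?S) *\<^sub>R (k / ?d * x v)"
      using d by (simp add: ev scaleR_conv_of_real flip: out_degree_eq_card)
    show "cmod (\<phi> (v, u) * x u) \<le> cmod (k / ?d * x v)" if "u \<in> ?S" for u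
      using le[OF that] d k by (simp add: norm_mult norm_divide)
  qed (use w in auto)
qed

lemma obtain_max_vertex:
  assumes "\<exists>v\<in>pverts D. x v \<noteq> (0 :: complex)"
  obtains v where "v \<in> pverts D" "x v \<noteq> 0" "\<And>w. w \<in> pverts D \<Longrightarrow> cmod (x w) \<le> cmod (x v)"
proof -
  have "finite (pverts D)" "pverts D \<noteq> {}"
    using assms by (auto intro: pair_finite_verts)
  then obtain v where v: "v \<in> pverts D" "\<And>w. w \<in> pverts D \<Longrightarrow> cmod (x w) \<le> cmod (x v)"
    using obtains_MAX[of "pverts D" "\<lambda>v. cmod (x v)"] by (metis Max_ge finite_imageI imageI)
  moreover have "x v \<noteq> 0"
    using assms v by force
  ultimately show thesis
    using that by blast
qed

lemma norm_eigenvalue_le: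
  assumes "distinct vs" and "set vs = pverts D" and "eigenvalue (gain_adj_mat vs D \<phi>) k"
  shows "cmod k \<le> max_out_degree D"
proof -
  obtain x where x: "\<exists>v\<in>pverts D. x v \<noteq> 0"
    "\<And>v. v \<in> pverts D \<Longrightarrow> (\<Sum>w | (v, w) \<in> parcs D. \<phi> (v, w) * x w) = k * x v"
    using assms(3) unfolding eigenvalue_gain_adj_mat_iff[OF assms(1,2)] by blast
  from obtain_max_vertex[OF x(1)] obtain v where v: "v \<in> pverts D" "x v \<noteq> 0"
    "\<And>w. w \<in> pverts D \<Longrightarrow> cmod (x w) \<le> cmod (x v)" by blast
  have "cmod k \<le> out_degree (with_proj D) v"
    using v by (intro eigenvalue_at_max_vertex(1)[of v x] x(2))
  also have "\<dots> \<le> max_out_degree D"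
    using out_degree_le_max[OF v(1)] by simp
  finally show ?thesis .
qed

section \<open>Potentials and gains of closed walks\<close>

text \<open>The relation telescopes: every arc of the walk contributes its gain on the left and one
  factor \<open>\<mu>\<close> on the right.\<close>

lemma walk_gain_potential:
  fixes \<mu> :: complex
  assumes pot: "\<And>v w. (v, w) \<in> parcs D \<Longrightarrow> \<phi> (v, w) * x w = \<mu> * x v" and "awalk u p v"
  shows "walk_gain \<phi> p * x v = \<mu> ^ length p * x u"
  using assms(2)
proof (induction p arbitrary: u)
  case (Cons e p)
  obtain w where e: "e = (u, w)" "(u, w) \<in> parcs D" and p: "awalk w p v"
    using Cons.prems by (cases e) (auto simp: awalk_Cons_iff)
  have "walk_gain \<phi> (e # p) * x v = \<mu> ^ length p * (\<phi> (u, w) * x w)"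
    using Cons.IH[OF p] by (simp add: e(1) mult.assoc mult.left_commute)
  then show ?case
    by (simp add: pot[OF e(2)])
qed (simp add: awalk_Nil_iff)

text \<open>A cycle returns to its start \<open>u\<close>, so the nonzero factor \<open>x u\<close>
  cancels from the telescoped relation.\<close>

lemma balanced_if_potential:
  fixes \<mu> :: complex
  assumes "\<And>v w. (v, w) \<in> parcs D \<Longrightarrow> \<phi> (v, w) * x w = \<mu> * x v"
    and "\<And>v. v \<in> pverts D \<Longrightarrow> x v \<noteq> 0"
  shows "balanced \<mu> D \<phi>"
  unfolding balanced_def
proof (intro allI impI)
  fix C assume "cycle C"
  then obtain u where C: "awalk u C u"
    by (auto simp: cycle_def)
  then have "x u \<noteq> 0"
    by (intro assms(2)) auto
  then show "walk_gain \<phi> C = \<mu> ^ length C"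
    using walk_gain_potential[of x \<mu>, OF assms(1) C] by simp
qed

text \<open>Induction on the length: a nonempty closed walk that is not a cycle splits at a repeated
  vertex into two shorter closed walks; gains multiply and lengths add.\<close>

lemma balanced_closed_walk:
  fixes \<mu> :: complex
  assumes "balanced \<mu> D \<phi>" and "awalk u p u"
  shows "walk_gain \<phi> p = \<mu> ^ length p"
  using assms(2)
proof (induction "length p" arbitrary: p u rule: less_induct)
  case less
  show ?case
  proof (cases "p = [] \<or> distinct (tl (pawalk_verts u p))")
    case True
    then show ?thesis
      using assms(1) less.prems by (cases "p = []") (auto simp: balanced_def cycle_def)
  next
    case False
    \<comment> \<open>The start \<open>u\<close> always recurs at the end, so the repetition is
      sought in the rest \<open>es\<close> after the first arc. Keeping \<open>e\<close> outside the
      loop \<open>r\<close> makes \<open>r\<close> shorter than \<open>p\<close>.\<close>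
    then obtain e es where p: "p = e # es" by (cases p) auto
    with False less.prems have "awalk (snd e) es u" "\<not> distinct (pawalk_verts (snd e) es)"
      by (auto simp: awalk_Cons_iff)
    from awalk_not_distinct_decomp[OF this] obtain q r s w where
      es: "es = q @ r @ s" "r \<noteq> []" "awalk (snd e) q w" "awalk w r w" "awalk w s u"
      by auto
    have "awalk u (e # q @ s) u"
      using es less.prems p by (auto simp: awalk_Cons_iff)
    moreover have "length (e # q @ s) < length p"
      using es p by simp
    ultimately have "walk_gain \<phi> (e # q @ s) = \<mu> ^ length (e # q @ s)"
      by (intro less.hyps)
    moreover have "walk_gain \<phi> r = \<mu> ^ length r"
      using es p by (intro less.hyps) auto
    moreover have "walk_gain \<phi> p = walk_gain \<phi> (e # q @ s) * walk_gain \<phi> r"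
      by (simp add: p es mult_ac)
    ultimately show ?thesis
      by (simp add: p es power_add mult_ac)
  qed
qed

section \<open>From an eigenvalue of maximal modulus to regularity and balance\<close>

lemma eigenvalue_max_out_degree_imp:
  assumes "distinct vs" and "set vs = pverts D" and conn: "strongly_connected (with_proj D)"
    and "eigenvalue (gain_adj_mat vs D \<phi>) k" and k: "cmod k = max_out_degree D"
  shows "out_regular D (max_out_degree D)" and "\<exists>\<mu>\<in>unit_circle. balanced \<mu> D \<phi>"
proof -
  let ?\<Delta> = "max_out_degree D"
  obtain x where x: "\<exists>v\<in>pverts D. x v \<noteq> 0"
    "\<And>v. v \<in> pverts D \<Longrightarrow> (\<Sum>w | (v, w) \<in> parcs D. \<phi> (v, w) * x w) = k * x v"
    using assms(4) unfolding eigenvalue_gain_adj_mat_iff[OF assms(1,2)] by blast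
  from obtain_max_vertex[OF x(1)] obtain u where u: "u \<in> pverts D" "x u \<noteq> 0"
    "\<And>w. w \<in> pverts D \<Longrightarrow> cmod (x w) \<le> cmod (x u)" by blast
  \<comment> \<open>Stated for every vertex of maximal modulus, not only for \<open>u\<close>, so
    that it can be carried along walks.\<close>
  have deg: "out_degree (with_proj D) v = ?\<Delta>"
    and pot: "(v, w) \<in> parcs D \<Longrightarrow> \<phi> (v, w) * x w = k / ?\<Delta> * x v"
    if v: "v \<in> pverts D" "cmod (x v) = cmod (x u)" for v w
  proof -
    have v': "x v \<noteq> 0" "\<And>w. w \<in> pverts D \<Longrightarrow> cmod (x w) \<le> cmod (x v)"
      using u v by auto
    note max = eigenvalue_at_max_vertex[OF v(1) v' x(2)[OF v(1)]]
    show deg: "out_degree (with_proj D) v = ?\<Delta>"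
      using max(1) k out_degree_le_max[OF v(1)] by simp
    show "\<phi> (v, w) * x w = k / ?\<Delta> * x v" if "(v, w) \<in> parcs D"
      using max(2)[OF _ _ that] k by (simp add: deg)
  qed
  have arc_pos: "?\<Delta> > 0" if "(v, w) \<in> parcs D" for v w
  proof -
    have "0 < out_degree (with_proj D) v"
      using that by (auto simp: out_degree_eq_card card_gt_0_iff)
    then show ?thesis
      using out_degree_le_max[of v] in_arcsD1[OF that] by simp
  qed
  have walk: "awalk v p w \<Longrightarrow> cmod (x v) = cmod (x u) \<Longrightarrow> cmod (x w) = cmod (x u)" for v p w
  proof (induction p arbitrary: v)
    case (Cons e p)
    obtain z where e: "(v, z) \<in> parcs D" and p: "awalk z p w"
      using Cons.prems by (cases e) (auto simp: awalk_Cons_iff)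
    \<comment> \<open>The arc gives \<open>?\<Delta> > 0\<close>, so \<open>k / ?\<Delta>\<close>
      has modulus 1 like the gain; hence maximal modulus passes from \<open>v\<close> to
      \<open>z\<close>.\<close>
    have "cmod (\<phi> (v, z) * x z) = cmod (k / ?\<Delta> * x v)"
      using pot[OF _ Cons.prems(2) e] in_arcsD1[OF e] by simp
    then have "cmod (x z) = cmod (x v)"
      using arc_pos[OF e] by (simp add: norm_mult norm_divide k norm_gain[OF e])
    then show ?case
      using Cons p by simp
  qed (simp add: awalk_Nil_iff)
  have all: "cmod (x v) = cmod (x u)" if "v \<in> pverts D" for v
  proof -
    have "u \<rightarrow>\<^sup>*\<^bsub>with_proj D\<^esub> v"
      using conn u(1) that by auto
    then show ?thesis
      using walk by (auto simp: reachable_awalk)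
  qed
  show "out_regular D ?\<Delta>"
    using deg all by (simp add: out_regular_def)
  have nz: "x v \<noteq> 0" if "v \<in> pverts D" for v
    using all[OF that] u(2) by auto
  show "\<exists>\<mu>\<in>unit_circle. balanced \<mu> D \<phi>"
  proof (cases "?\<Delta> = 0")
    \<comment> \<open>Here \<open>k / ?\<Delta>\<close> is 0 by convention and lies off the unit
      circle. But there are no arcs, so any unit is admissible and 1 is chosen.\<close>
    case True
    then have "balanced 1 D \<phi>"
      using arc_pos by (intro balanced_if_potential[of "\<lambda>_. 1"]) auto
    then show ?thesis
      by (intro bexI[of _ 1]) (auto simp: unit_circle_def)
  next
    case False
    have "balanced (k / ?\<Delta>) D \<phi>"
      by (rule balanced_if_potential[of x]) (use pot all nz in_arcsD1 in blast)+
    moreover have "k / ?\<Delta> \<in> unit_circle"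
      using False k by (simp add: unit_circle_def norm_divide)
    ultimately show ?thesis by blast
  qed
qed

section \<open>From balance to an eigenvalue\<close>

lemma potential_if_balanced:
  fixes \<mu> :: complex
  assumes conn: "strongly_connected (with_proj D)" and bal: "balanced \<mu> D \<phi>" and "\<mu> \<noteq> 0"
  obtains x where "\<And>v. v \<in> pverts D \<Longrightarrow> x v \<noteq> 0"
    and "\<And>v w. (v, w) \<in> parcs D \<Longrightarrow> \<phi> (v, w) * x w = \<mu> * x v"
proof -
  obtain r where r: "r \<in> pverts D"
    using conn by (auto simp: strongly_connected_def)
  have walk: "\<exists>p. awalk v p w" if "v \<in> pverts D" "w \<in> pverts D" for v w
  proof -
    have "v \<rightarrow>\<^sup>*\<^bsub>with_proj D\<^esub> w"
      using conn that by auto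
    then show ?thesis by (simp add: reachable_awalk)
  qed
  \<comment> \<open>The value that the desired relation forces at the end of \<open>p\<close> when
    the root \<open>r\<close> has value 1.\<close>
  define pot where "pot p = \<mu> ^ length p / walk_gain \<phi> p" for p
  have indep: "pot p = pot q" if p: "awalk r p v" and q: "awalk r q v" for p q v
  proof -
    \<comment> \<open>A return walk \<open>s\<close> closes \<open>p\<close> and \<open>q\<close>
      alike, and balance then expresses both values through \<open>s\<close> alone.\<close>
    obtain s where s: "awalk v s r"
      using walk[of v r] r p by auto
    have "walk_gain \<phi> (p @ s) = \<mu> ^ length (p @ s)" "walk_gain \<phi> (q @ s) = \<mu> ^ length (q @ s)"
      using awalk_appendI[OF p s] awalk_appendI[OF q s] balanced_closed_walk[OF bal] by blast+
    then have "pot p = walk_gain \<phi> s / \<mu> ^ length s" "pot q = walk_gain \<phi> s / \<mu> ^ length s"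
      using walk_gain_nonzero[OF p] walk_gain_nonzero[OF q] \<open>\<mu> \<noteq> 0\<close>
      by (simp_all add: pot_def field_simps power_add)
    then show ?thesis by simp
  qed
  define x where "x v = pot (SOME p. awalk r p v)" for v
  have x: "x v = pot p" if "awalk r p v" for v p
    unfolding x_def using that by (intro indep[of _ v]) (auto intro: someI)
  show thesis
  proof (rule that[of x])
    fix v assume "v \<in> pverts D"
    then obtain p where p: "awalk r p v" using walk r by blast
    show "x v \<noteq> 0"
      using walk_gain_nonzero[OF p] \<open>\<mu> \<noteq> 0\<close> by (simp add: x[OF p] pot_def)
  next
    fix v w assume vw: "(v, w) \<in> parcs D"
    then obtain p where p: "awalk r p v" using walk r in_arcsD1 by blast
    \<comment> \<open>Appending the arc to \<open>p\<close> multiplies \<open>pot\<close> by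
      \<open>\<mu> / \<phi> (v, w)\<close>, which is the required relation.\<close>
    have "awalk v [(v, w)] w"
      using vw by (auto simp: awalk_Cons_iff awalk_Nil_iff dest: in_arcsD2)
    with p have q: "awalk r (p @ [(v, w)]) w"
      by (rule awalk_appendI)
    have "\<phi> (v, w) \<noteq> 0"
      using norm_gain[OF vw] by auto
    then show "\<phi> (v, w) * x w = \<mu> * x v"
      by (simp add: x[OF p] x[OF q] pot_def)
  qed
qed

text \<open>Each of the \<open>d\<close> out-neighbours of \<open>v\<close> contributes
  \<open>\<mu> * x v\<close> to the sum, so the potential is an eigenvector.\<close>

lemma eigenvalue_if_regular_balanced:
  fixes \<mu> :: complex
  assumes "distinct vs" and "set vs = pverts D" and conn: "strongly_connected (with_proj D)"
    and reg: "out_regular D d" and "balanced \<mu> D \<phi>" and "\<mu> \<noteq> 0"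
  shows "eigenvalue (gain_adj_mat vs D \<phi>) (of_nat d * \<mu>)"
proof -
  obtain x where nz: "\<And>v. v \<in> pverts D \<Longrightarrow> x v \<noteq> 0"
    and pot: "\<And>v w. (v, w) \<in> parcs D \<Longrightarrow> \<phi> (v, w) * x w = \<mu> * x v"
    using potential_if_balanced[OF conn assms(5,6)] by blast
  have "(\<Sum>w | (v, w) \<in> parcs D. \<phi> (v, w) * x w) = of_nat d * \<mu> * x v" if "v \<in> pverts D" for v
    using reg that by (simp add: pot out_regular_def out_degree_eq_card)
  moreover have "\<exists>v\<in>pverts D. x v \<noteq> 0"
    using nz conn by (auto simp: strongly_connected_def)
  ultimately show ?thesis
    using eigenvalue_gain_adj_mat_iff[OF assms(1,2)] by blast
qed

end

theorem corollary3p9: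
  fixes D :: "'a pair_pre_digraph"
    and \<phi> :: "'a \<times> 'a \<Rightarrow> complex"
    and vs :: "'a list"
  assumes "is_T_gain_digraph D \<phi>"
    and "distinct vs" and "set vs = pverts D"
    and "strongly_connected (with_proj D)"
  shows "spectral_radius (gain_adj_mat vs D \<phi>) = real (max_out_degree D) \<longleftrightarrow>
    out_regular D (max_out_degree D) \<and> (\<exists>\<mu> \<in> unit_circle. balanced \<mu> D \<phi>)"
proof -
  interpret pair_digraph D
    using assms(1) by (simp add: is_T_gain_digraph_def)
  interpret T_gain_digraph D \<phi>
    using assms(1) by unfold_locales (simp add: is_T_gain_digraph_def unit_circle_def)
  let ?A = "gain_adj_mat vs D \<phi>" and ?\<Delta> = "max_out_degree D"
  have A: "?A \<in> carrier_mat (length vs) (length vs)"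
    by (simp add: gain_adj_mat_def)
  \<comment> \<open>Strong connectivity includes a nonempty vertex set, so the spectrum is nonempty
    and its maximal modulus is attained.\<close>
  have pos: "length vs > 0"
    using assms(3,4) by (auto simp: strongly_connected_def)
  note radius = spectral_radius_mem_max[OF A pos]
  show ?thesis
  proof
    assume "spectral_radius ?A = ?\<Delta>"
    then obtain k where "eigenvalue ?A k" "cmod k = ?\<Delta>"
      using radius(1) by (auto simp: spectrum_def)
    then show "out_regular D ?\<Delta> \<and> (\<exists>\<mu>\<in>unit_circle. balanced \<mu> D \<phi>)"
      using eigenvalue_max_out_degree_imp[OF assms(2-4)] by blast
  next
    assume "out_regular D ?\<Delta> \<and> (\<exists>\<mu>\<in>unit_circle. balanced \<mu> D \<phi>)"
    then obtain \<mu> where \<mu>: "out_regular D ?\<Delta>" "balanced \<mu> D \<phi>" "cmod \<mu> = 1"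
      by (auto simp: unit_circle_def)
    then have "eigenvalue ?A (of_nat ?\<Delta> * \<mu>)"
      by (intro eigenvalue_if_regular_balanced[OF assms(2-4)]) auto
    \<comment> \<open>This eigenvalue has modulus \<open>?\<Delta>\<close>, which bounds the radius
      from below; the bound on all eigenvalues gives the other inequality.\<close>
    then have "cmod (of_nat ?\<Delta> * \<mu>) \<in> cmod ` spectrum ?A"
      by (simp add: spectrum_def)
    from radius(2)[OF this] have "?\<Delta> \<le> spectral_radius ?A"
      using \<mu>(3) by (simp add: norm_mult)
    moreover have "spectral_radius ?A \<le> ?\<Delta>"
      using radius(1) norm_eigenvalue_le[OF assms(2,3)] by (auto simp: spectrum_def)
    ultimately show "spectral_radius ?A = ?\<Delta>"
      by (rule antisym[rotated])
  qed
qed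

end
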